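(* Let $a=(a_1,a_2) \in S^1$ with $1 \ge a_1 \ge a_2 > 0$ and let $t \ge 0$. Define $$f(a_1,a_2,t;r) := \frac{t^2 - a_2^2 + 2a_2^2 r + (a_1^2-a_2^2) r^2}{2ta_1r}, \quad r \in [0,1].$$ Then $$A_{1,\mathbb{C}}(a,t) = \begin{cases} \displaystyle \pi\left(\frac{1-t/a_2}{a_1+a_2}\right)^2 + \frac{2}{a_2^2}\int_{\frac{a_2-t}{a_1+a_2}}^{\frac{a_2+t}{a_1+a_2}} \arccos(f(a_1,a_2,t;r))\, r\,dr, & 0 \le t \le a_2,\\[4mm] \displaystyle \frac{2}{a_2^2}\int_{\frac{t-a_2}{a_1-a_2}}^{\frac{t+a_2}{a_1+a_2}} \arccos(f(a_1,a_2,t;r))\, r\,dr, & a_2 < t \le a_1.\end{cases}$$ In particular, with $a^{(1)} = (1,0)$, $a^{(2)} = \frac{1}{\sqrt 2}(1,1)$ and $a^{[t]} = (\sqrt{1-t^2},t)$, $$A_{1,\mathbb{C}}(a^{(1)},t) = \pi(1-t)^2, \quad 0 \le t \le 1,$$ $$A_{1,\mathbb{C}}(a^{(2)},t) = \frac{\pi}{2}\sqrt{1-2t^2}, \quad 0 \le t \le \frac{1}{\sqrt 2},$$ $$A_{1,\mathbb{C}}(a^{[t]},t) = \frac{2(1+t^2)}{(1-2t^2)^2}\arccos\!\left(\frac{t}{\sqrt{1-t^2}}\right) - \frac{6t}{(1-2t^2)^{3/2}}, \quad 0 \le t < \frac{1}{\sqrt 2}.$$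
   Context: Let $B_1^2 := \{z=(z_1,z_2) \in \mathbb{C}^2 : |z_1|+|z_2| \le 1\}$ be the complex $l_1^2$-ball. For $a \in \mathbb{C}^2$ with $\|a\|_2 = 1$ and $t \in \mathbb{C}$ define $$A_{1,\mathbb{C}}(a,t) := \mathrm{vol}_2(\{z \in B_1^2 : \langle a,z\rangle = t\}),$$ where $\langle\cdot,\cdot\rangle$ is the scalar product in $\mathbb{C}^2$ and $\mathrm{vol}_2$ is the real $2$-dimensional Lebesgue measure on the complex line $\{z : \langle a,z\rangle = t\}$, identifying $\mathbb{C}^2$ with $\mathbb{R}^4$. $S^1$ is the Euclidean unit circle in $\mathbb{R}^2$. For $t=0$ the integral over the degenerate interval in the first case is $0$. *)

theory Defs
  imports "HOL-Analysis.Analysis"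
begin

text \<open>
  The norm of \<^typ>\<open>complex^2\<close> is the Euclidean norm of $\mathbb{C}^2 = \mathbb{R}^4$.
\<close>

definition B1 :: "(complex^2) set" where
  "B1 = {z. cmod (z $ 1) + cmod (z $ 2) \<le> 1}"

definition cinner :: "complex^'n \<Rightarrow> complex^'n \<Rightarrow> complex" where
  "cinner z w = (\<Sum>i\<in>UNIV. z $ i * cnj (w $ i))"

definition complex_line :: "complex^2 \<Rightarrow> complex \<Rightarrow> (complex^2) set" where
  "complex_line a t = {z. cinner a z = t}"

definition isometric_param :: "(real^2 \<Rightarrow> 'a::metric_space) \<Rightarrow> 'a set \<Rightarrow> bool" where
  "isometric_param \<phi> L \<longleftrightarrow> (\<forall>x y. dist (\<phi> x) (\<phi> y) = dist x y) \<and> range \<phi> = L"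

text \<open>
  Lebesgue measure on a real affine plane \<open>L\<close>, transported from $\mathbb{R}^2$ by an arbitrary
  isometry onto \<open>L\<close>; \<open>vol2_eq\<close> below shows that the choice of the isometry is immaterial.
\<close>

definition vol2 :: "'a::metric_space set \<Rightarrow> 'a set \<Rightarrow> real" where
  "vol2 L S = measure lebesgue ((SOME \<phi>. isometric_param \<phi> L) -` S)"

lemma isometric_param_transition:
  fixes \<phi> \<psi> :: "real^2 \<Rightarrow> 'a::metric_space"
  assumes "isometric_param \<phi> L" "isometric_param \<psi> L" and S: "\<phi> -` S \<in> lmeasurable"
  shows "\<psi> -` S \<in> lmeasurable \<and> measure lebesgue (\<psi> -` S) = measure lebesgue (\<phi> -` S)"
proof -
  have d\<phi>: "dist (\<phi> x) (\<phi> y) = dist x y" and d\<psi>: "dist (\<psi> x) (\<psi> y) = dist x y"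
    and r: "range \<phi> = range \<psi>" for x y
    using assms by (auto simp: isometric_param_def)
  have inj: "inj \<psi>"
    using d\<psi> by (metis dist_eq_0_iff injI)
  define g where "g = inv \<psi> \<circ> \<phi>"
  have \<psi>g: "\<psi> (g x) = \<phi> x" for x
    unfolding g_def using r by (metis comp_apply f_inv_into_f rangeI)
  have dg: "dist (g x) (g y) = dist x y" for x y
    by (metis \<psi>g d\<phi> d\<psi>)
  define h where "h = (\<lambda>x. g x - g 0)"
  have h: "orthogonal_transformation h"
    unfolding orthogonal_transformation_isometry h_def using dg by (simp add: dist_norm)
  have img: "\<psi> -` S = (+) (g 0) ` (h ` (\<phi> -` S))"
  proof -
    have "(+) (g 0) ` (h ` (\<phi> -` S)) = g ` (\<phi> -` S)"
      by (simp add: h_def image_image)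
    also have "\<dots> = \<psi> -` S"
    proof (intro equalityI subsetI)
      fix y assume "y \<in> \<psi> -` S"
      moreover obtain x where x: "\<phi> x = \<psi> y"
        using r by (metis imageE rangeI)
      moreover have "g x = y"
        using x \<psi>g inj by (metis injD)
      ultimately show "y \<in> g ` (\<phi> -` S)" by auto
    qed (auto simp: \<psi>g)
    finally show ?thesis ..
  qed
  show ?thesis
    unfolding img measure_translation
    using measurable_translation measurable_orthogonal_image[OF h S] measure_orthogonal_image[OF h S]
    by blast
qed

lemma vol2_eq:
  fixes \<phi> :: "real^2 \<Rightarrow> 'a::metric_space"
  assumes "isometric_param \<phi> L"
  shows "vol2 L S = measure lebesgue (\<phi> -` S)"
proof -
  define \<psi> :: "real^2 \<Rightarrow> 'a" where "\<psi> = (SOME \<phi>. isometric_param \<phi> L)"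
  have \<psi>: "isometric_param \<psi> L"
    unfolding \<psi>_def using someI[of "\<lambda>\<phi>. isometric_param \<phi> L", OF assms] .
  have "measure lebesgue (\<psi> -` S) = measure lebesgue (\<phi> -` S)"
  proof (cases "\<phi> -` S \<in> lmeasurable \<or> \<psi> -` S \<in> lmeasurable")
    case True
    then show ?thesis
      using isometric_param_transition assms \<psi> by metis
  next
    case False
    moreover have "measure lebesgue T = 0" if "T \<notin> lmeasurable" for T :: "(real^2) set"
    proof (cases "T \<in> sets lebesgue")
      case True
      then have "emeasure lebesgue T = \<infinity>"
        using that by (metis fmeasurableI infinity_ennreal_def less_top)
      then show ?thesis by (simp only: measure_def enn2real_top infinity_ennreal_def)
    qed (rule measure_notin_sets)
    ultimately show ?thesis by simp
  qed
  then show ?thesis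
    by (simp add: vol2_def \<psi>_def)
qed

definition A1C :: "complex^2 \<Rightarrow> complex \<Rightarrow> real" where
  "A1C a t = vol2 (complex_line a t) {z \<in> B1. cinner a z = t}"

definition cvec :: "real^'n \<Rightarrow> complex^'n" where
  "cvec a = (\<chi> i. complex_of_real (a $ i))"

definition f_sec :: "real \<Rightarrow> real \<Rightarrow> real \<Rightarrow> real \<Rightarrow> real" where
  "f_sec a1 a2 t r = (t\<^sup>2 - a2\<^sup>2 + 2 * a2\<^sup>2 * r + (a1\<^sup>2 - a2\<^sup>2) * r\<^sup>2) / (2 * t * a1 * r)"

end

theory Submission
  imports Defs
begin

text \<open>
  The complex line \<open>a\<^sub>1 z\<^sub>1 + a\<^sub>2 z\<^sub>2 = t\<close> has dimension one over the complex numbers, so for \<open>a\<^sub>2 > 0\<close> a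
  point of it is determined by \<open>u = z\<^sub>1\<close>, and \<open>z\<^sub>2 = (t - a\<^sub>1 u) / a\<^sub>2\<close>. The projection to \<open>u\<close> shrinks lengths
  by the factor \<open>a\<^sub>2\<close>, hence the section has area \<open>1 / a\<^sub>2\<^sup>2\<close> times that of the plane region
  \<open>\<bar>t - a\<^sub>1 u\<bar> \<le> a\<^sub>2 (1 - \<bar>u\<bar>)\<close> (\<open>A1C_eq_section_z1\<close>).

  In polar coordinates \<open>u = r e\<^sup>i\<^sup>\<theta>\<close>, squaring turns this inequality into \<open>cos \<theta> \<ge> f(r)\<close>. On the circle of
  radius \<open>r\<close> it holds everywhere if \<open>f(r) \<le> -1\<close>, nowhere if \<open>f(r) > 1\<close>, and otherwise on an arc of length
  \<open>2 r arccos (f(r))\<close>. The three regimes change exactly at the integration limits of the proposition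
  (\<open>measure_section_z1\<close>): for \<open>t \<le> a\<^sub>2\<close> the small radii contribute a full disc, for \<open>t > a\<^sub>2\<close> nothing.

  Area in polar coordinates comes from the map that takes a radius \<open>r\<close> and an arc length \<open>s\<close> to the point
  with polar coordinates \<open>(r, s / r)\<close>. Its Jacobian determinant is 1, so the area of a region is the area of
  its parameter set (\<open>measure_arc_polar\<close>), and the parameter sets that occur here have slices of length
  \<open>2 r arccos (f(r))\<close> (\<open>measure_polar_region\<close>).

  The three closed forms: for \<open>a = (1, 0)\<close> the section is a disc; for \<open>a\<^sub>1 = a\<^sub>2\<close> it is an ellipse with foci
  at distance \<open>t\<close> from the centre (\<open>measure_ellipse\<close>); for \<open>t = a\<^sub>2\<close> the function \<open>f\<close> is affine in \<open>r\<close>, and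
  the integral has an elementary antiderivative (\<open>has_integral_arccos_moment\<close>).
\<close>

section \<open>Area in the plane by polar coordinates\<close>

lemma norm_real2: "norm (x::real^2) = sqrt ((x$1)\<^sup>2 + (x$2)\<^sup>2)"
  by (simp add: norm_vec_def L2_set_def sum_2)

lemma borel_measurable_vector_2 [measurable]:
  fixes f g :: "'a \<Rightarrow> real"
  assumes [measurable]: "f \<in> borel_measurable M" "g \<in> borel_measurable M"
  shows "(\<lambda>x. vector [f x, g x] :: real^2) \<in> borel_measurable M"
proof (subst borel_measurable_euclidean_space, rule ballI)
  fix b :: "real^2" assume "b \<in> Basis"
  then consider "b = axis 1 1" | "b = axis 2 1"
    by (metis axis_inverse exhaust_2)
  then show "(\<lambda>x. (vector [f x, g x] :: real^2) \<bullet> b) \<in> borel_measurable M"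
    by cases (simp_all add: inner_axis)
qed

lemma measurable_pair_to_real2:
  "(\<lambda>(r, s). vector [r, s] :: real^2) \<in> borel_measurable borel"
  unfolding borel_prod[symmetric] case_prod_beta by measurable

lemma Basis_real2: "(Basis :: (real^2) set) = {axis 1 1, axis 2 1}"
  by (auto simp: Basis_vec_def UNIV_2)

lemma axis_12_neq: "axis 1 1 \<noteq> (axis 2 1 :: real^2)"
  by (simp add: axis_eq_axis)

text \<open>
  Carries Fubini's theorem over from pairs of reals to \<^typ>\<open>real^2\<close>.
\<close>

lemma lborel_real2: "lborel = distr lborel borel (\<lambda>(r, s). vector [r, s] :: real^2)"
proof (rule lborel_eqI)
  fix l u :: "real^2"
  assume le: "\<And>b. b \<in> Basis \<Longrightarrow> l \<bullet> b \<le> u \<bullet> b"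
  have le1: "l$1 \<le> u$1" and le2: "l$2 \<le> u$2"
    using le[of "axis 1 1"] le[of "axis 2 1"] by (simp_all add: Basis_real2 inner_axis)
  have box: "(\<lambda>(r, s). vector [r, s] :: real^2) -` box l u = {l$1<..<u$1} \<times> {l$2<..<u$2}"
    by (auto simp: mem_box_cart forall_2)
  have [measurable]: "(\<lambda>(r, s). vector [r, s] :: real^2) \<in> borel_measurable borel"
    by (rule measurable_pair_to_real2)
  have "emeasure (distr lborel borel (\<lambda>(r, s). vector [r, s] :: real^2)) (box l u) =
        emeasure lborel ({l$1<..<u$1} \<times> {l$2<..<u$2})"
    by (subst emeasure_distr) (auto simp: box)
  also have "\<dots> = emeasure lborel {l$1<..<u$1} * emeasure lborel {l$2<..<u$2}"
    unfolding lborel_prod[symmetric] by (rule lborel.emeasure_pair_measure_Times) auto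
  also have "\<dots> = ennreal ((u$1 - l$1) * (u$2 - l$2))"
    using le1 le2 by (simp add: ennreal_mult)
  finally show "emeasure (distr lborel borel (\<lambda>(r, s). vector [r, s] :: real^2)) (box l u) =
        (\<Prod>b\<in>Basis. (u - l) \<bullet> b)"
    by (simp add: Basis_real2 axis_12_neq inner_axis)
qed simp

lemma emeasure_real2_slices:
  fixes A :: "(real^2) set"
  assumes [measurable]: "A \<in> sets borel"
  shows "emeasure lborel A = (\<integral>\<^sup>+r. emeasure lborel {s. vector [r, s] \<in> A} \<partial>lborel)"
proof -
  have m: "(\<lambda>(r, s). vector [r, s] :: real^2) \<in> borel_measurable borel"
    by (rule measurable_pair_to_real2)
  have m': "(\<lambda>(r, s). vector [r, s] :: real^2) -` A \<in> sets borel"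
    using measurable_sets[OF m assms] by simp
  have "emeasure lborel A = emeasure lborel ((\<lambda>(r, s). vector [r, s] :: real^2) -` A)"
    by (subst lborel_real2) (use m in \<open>simp add: emeasure_distr\<close>)
  also have "\<dots> = (\<integral>\<^sup>+r. emeasure lborel (Pair r -` (\<lambda>(r, s). vector [r, s] :: real^2) -` A) \<partial>lborel)"
    unfolding lborel_prod[symmetric]
    by (rule lborel.emeasure_pair_measure_alt) (use m' in \<open>simp only: lborel_prod sets_lborel\<close>)
  finally show ?thesis by (simp add: vimage_def)
qed

text \<open>
  \<open>x$1\<close> is the radius and \<open>x$2\<close> the arc length along the circle of that radius. Measuring the angle by arc
  length instead of radians is what makes the map area-preserving.
\<close>

definition arc_polar :: "real^2 \<Rightarrow> real^2" where
  "arc_polar x = vector [x$1 * cos (x$2 / x$1), x$1 * sin (x$2 / x$1)]"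

text \<open>
  The angle ranges over the half-open interval of the principal argument, so that every nonzero point has
  exactly one preimage.
\<close>

definition arc_polar_dom :: "(real^2) set" where
  "arc_polar_dom = {x. 0 < x$1 \<and> - pi * x$1 < x$2 \<and> x$2 \<le> pi * x$1}"

lemma bij_arc_polar: "bij_betw arc_polar arc_polar_dom (- {0})"
proof -
  define u :: "real^2 \<Rightarrow> real^2" where
    "u y = (let z = Complex (y$1) (y$2) in vector [cmod z, cmod z * Arg z])" for y
  show ?thesis
  proof (rule bij_betwI[where g = u])
    show "arc_polar \<in> arc_polar_dom \<rightarrow> - {0}"
    proof
      fix x assume "x \<in> arc_polar_dom"
      then have "0 < x$1" by (simp add: arc_polar_dom_def)
      moreover have "cos (x$2 / x$1) \<noteq> 0 \<or> sin (x$2 / x$1) \<noteq> 0"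
        using sin_cos_squared_add2[of "x$2 / x$1"] by force
      ultimately show "arc_polar x \<in> - {0}"
        by (auto simp: arc_polar_def vec_eq_iff forall_2)
    qed
  next
    show "u \<in> - {0} \<rightarrow> arc_polar_dom"
    proof
      fix y :: "real^2" assume "y \<in> - {0}"
      then have "0 < cmod (Complex (y$1) (y$2))"
        by (auto simp: vec_eq_iff forall_2 Complex_eq_0)
      moreover have "cmod z * (- pi) < cmod z * Arg z" "cmod z * Arg z \<le> cmod z * pi"
        if "0 < cmod z" for z
        using that Arg_bounded[of z] by (auto simp only: mult_less_cancel_left_pos mult_le_cancel_left_pos)
      ultimately show "u y \<in> arc_polar_dom"
        by (simp add: arc_polar_dom_def u_def Let_def mult.commute)
    qed
  next
    fix x assume "x \<in> arc_polar_dom"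
    then have x: "0 < x$1" "- pi < x$2 / x$1" "x$2 / x$1 \<le> pi"
      by (auto simp: arc_polar_dom_def field_simps)
    have "Complex (arc_polar x $ 1) (arc_polar x $ 2) = rcis (x$1) (x$2 / x$1)"
      by (simp add: arc_polar_def rcis_def complex_eq_iff)
    moreover have "cmod (rcis (x$1) (x$2 / x$1)) = x$1"
      using x by simp
    moreover have "Arg (rcis (x$1) (x$2 / x$1)) = x$2 / x$1"
      using x by (intro cis_Arg_unique) (auto simp: sgn_eq rcis_def norm_mult)
    ultimately show "u (arc_polar x) = x"
      using x by (simp add: u_def Let_def vec_eq_iff forall_2)
  next
    fix y :: "real^2" assume "y \<in> - {0}"
    define z where "z = Complex (y$1) (y$2)"
    have z: "z \<noteq> 0" using \<open>y \<in> - {0}\<close>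
      by (auto simp: z_def vec_eq_iff forall_2 Complex_eq_0)
    have "cmod z * cos (Arg z) = y$1" "cmod z * sin (Arg z) = y$2"
      using rcis_cmod_Arg[of z] by (auto simp: complex_eq_iff z_def simp del: rcis_cmod_Arg)
    then show "arc_polar (u y) = y"
      using z by (simp add: arc_polar_def vec_eq_iff forall_2 u_def Let_def flip: z_def)
  qed
qed

lemma norm_arc_polar: "norm (arc_polar x) = \<bar>x$1\<bar>"
proof -
  have "(x$1 * cos (x$2 / x$1))\<^sup>2 + (x$1 * sin (x$2 / x$1))\<^sup>2 = (x$1)\<^sup>2"
    by (simp only: power_mult_distrib sin_cos_squared_add2 mult_1_right flip: distrib_left)
  then show ?thesis
    by (simp add: norm_real2 arc_polar_def)
qed

lemma arc_polar_has_derivative: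
  fixes x :: "real^2"
  assumes "x$1 \<noteq> 0"
  defines "\<theta> \<equiv> x$2 / x$1"
  shows "(arc_polar has_derivative
      (\<lambda>h. vector [(cos \<theta> + \<theta> * sin \<theta>) * h$1 - sin \<theta> * h$2,
                   (sin \<theta> - \<theta> * cos \<theta>) * h$1 + cos \<theta> * h$2])) (at x within S)"
proof (subst has_derivative_componentwise_within, rule ballI)
  fix b :: "real^2" assume "b \<in> Basis"
  have [derivative_intros]: "((\<lambda>x::real^2. x$i) has_derivative (\<lambda>h. h$i)) (at x within S)" for i
    by (rule bounded_linear_imp_has_derivative) (rule bounded_linear_vec_nth)
  have 1: "((\<lambda>x. x$1 * cos (x$2 / x$1)) has_derivative
        (\<lambda>h. (cos \<theta> + \<theta> * sin \<theta>) * h$1 - sin \<theta> * h$2)) (at x within S)"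
    using assms(1) unfolding \<theta>_def
    by (auto intro!: derivative_eq_intros ext simp: field_simps)
  have 2: "((\<lambda>x. x$1 * sin (x$2 / x$1)) has_derivative
        (\<lambda>h. (sin \<theta> - \<theta> * cos \<theta>) * h$1 + cos \<theta> * h$2)) (at x within S)"
    using assms(1) unfolding \<theta>_def
    by (auto intro!: derivative_eq_intros ext simp: field_simps)
  from \<open>b \<in> Basis\<close> consider "b = axis 1 1" | "b = axis 2 1"
    by (auto simp: Basis_real2)
  then show "((\<lambda>x. arc_polar x \<bullet> b) has_derivative
      (\<lambda>h. vector [(cos \<theta> + \<theta> * sin \<theta>) * h$1 - sin \<theta> * h$2,
                   (sin \<theta> - \<theta> * cos \<theta>) * h$1 + cos \<theta> * h$2] \<bullet> b)) (at x within S)"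
    by cases (use 1 2 in \<open>simp_all add: inner_axis arc_polar_def\<close>)
qed

lemma arc_polar_measurable [measurable]: "arc_polar \<in> borel_measurable borel"
  unfolding arc_polar_def by measurable

lemma arc_polar_dom_sets [measurable]: "arc_polar_dom \<in> sets borel"
  unfolding arc_polar_dom_def by measurable

text \<open>
  The Jacobian matrix of \<^const>\<open>arc_polar\<close> has determinant \<open>sin\<^sup>2 \<theta> + cos\<^sup>2 \<theta> = 1\<close>: the products
  containing \<open>\<theta>\<close> as a factor cancel. The origin, which the map misses, is a null set.
\<close>

lemma measure_arc_polar:
  assumes E[measurable]: "E \<in> sets borel" and "bounded E"
  shows "measure lebesgue E = measure lebesgue (arc_polar_dom \<inter> arc_polar -` E)"
    and "arc_polar_dom \<inter> arc_polar -` E \<in> lmeasurable"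
proof -
  define T where "T = arc_polar_dom \<inter> arc_polar -` E"
  have T_borel: "T \<in> sets borel"
    unfolding T_def using measurable_sets[OF arc_polar_measurable E] by (simp add: sets.Int)
  obtain R where R: "\<And>y. y \<in> E \<Longrightarrow> norm y \<le> R"
    using \<open>bounded E\<close> by (auto simp: bounded_iff)
  have "norm x \<le> R + pi * R" if "x \<in> T" for x
  proof -
    have x: "0 < x$1" "\<bar>x$2\<bar> \<le> pi * x$1" "x$1 \<le> R"
      using that R[of "arc_polar x"] by (auto simp: T_def arc_polar_dom_def norm_arc_polar)
    have "norm x \<le> \<bar>x$1\<bar> + \<bar>x$2\<bar>"
      using norm_le_l1_cart[of x] by (simp add: sum_2)
    moreover have "pi * x$1 \<le> pi * R" using x by simp
    ultimately show ?thesis using x by linarith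
  qed
  then have "bounded T" by (auto simp: bounded_iff)
  then have T: "T \<in> lmeasurable"
    using T_borel by (intro bounded_set_imp_lmeasurable) auto
  then show "arc_polar_dom \<inter> arc_polar -` E \<in> lmeasurable" by (simp add: T_def)
  define D where "D x = (\<lambda>h::real^2. vector
      [(cos (x$2/x$1) + x$2/x$1 * sin (x$2/x$1)) * h$1 - sin (x$2/x$1) * h$2,
       (sin (x$2/x$1) - x$2/x$1 * cos (x$2/x$1)) * h$1 + cos (x$2/x$1) * h$2] :: real^2)"
    for x :: "real^2"
  have det: "det (matrix (D x)) = 1" for x
  proof -
    have "det (matrix (D x)) = (sin (x$2/x$1))\<^sup>2 + (cos (x$2/x$1))\<^sup>2"
      by (simp add: det_2 matrix_def D_def axis_def power2_eq_square algebra_simps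
          del: sin_cos_squared_add sin_cos_squared_add2)
    then show ?thesis by simp
  qed
  have "measure lebesgue (arc_polar ` T) = integral T (\<lambda>x. \<bar>det (matrix (D x))\<bar>)"
  proof (rule measure_differentiable_image_eq)
    show "T \<in> sets lebesgue" using T by auto
    show "(arc_polar has_derivative D x) (at x within T)" if "x \<in> T" for x
      using arc_polar_has_derivative[of x T] that
      unfolding D_def by (simp add: T_def arc_polar_dom_def)
    show "inj_on arc_polar T"
      by (rule inj_on_subset[OF bij_betw_imp_inj_on[OF bij_arc_polar]]) (simp add: T_def)
    show "(\<lambda>x. \<bar>det (matrix (D x))\<bar>) integrable_on T"
      using T by (simp add: det lmeasurable_iff_integrable_on)
  qed
  also have "\<dots> = measure lebesgue T"
    using T by (simp add: det lmeasure_integral)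
  also have "arc_polar ` T = E - {0}"
  proof -
    have "arc_polar ` T = arc_polar ` arc_polar_dom \<inter> E" by (auto simp: T_def)
    then show ?thesis using bij_arc_polar by (auto simp: bij_betw_def)
  qed
  also have "measure lebesgue (E - {0}) = measure lebesgue E"
  proof (rule measure_negligible_symdiff)
    show "E \<in> lmeasurable"
      using assms by (intro bounded_set_imp_lmeasurable) auto
    show "negligible (E - (E - {0}) \<union> (E - {0} - E))"
      by (rule negligible_subset[of "{0}"]) auto
  qed
  finally show "measure lebesgue E = measure lebesgue (arc_polar_dom \<inter> arc_polar -` E)"
    by (simp add: T_def)
qed

text \<open>
  On the circle of radius \<open>r\<close> the region is the arc \<open>cos \<theta> \<ge> h r\<close>, that is \<open>\<bar>\<theta>\<bar> \<le> arccos (h r)\<close>. The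
  inner circle is left out so that the region is disjoint from the closed disc of radius \<open>p\<close>.
\<close>

lemma measure_polar_region:
  fixes h :: "real \<Rightarrow> real"
  assumes [measurable]: "h \<in> borel_measurable borel" and p: "0 \<le> p"
    and h: "\<And>r. p < r \<Longrightarrow> r \<le> q \<Longrightarrow> \<bar>h r\<bar> \<le> 1"
  defines "E \<equiv> {x :: real^2. p < norm x \<and> norm x \<le> q \<and> norm x * h (norm x) \<le> x$1}"
  shows "E \<in> lmeasurable" and "measure lebesgue E = 2 * integral {p..q} (\<lambda>r. arccos (h r) * r)"
proof -
  have E[measurable]: "E \<in> sets borel"
    unfolding E_def by measurable
  have bE: "bounded E"
    by (auto simp: E_def bounded_iff)
  show "E \<in> lmeasurable"
    using E bE by (intro bounded_set_imp_lmeasurable) auto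
  \<comment> \<open>Truncation makes \<open>arccos\<close> of it a Borel function on the whole line; values of \<^const>\<open>arccos\<close>
    outside \<open>[-1, 1]\<close> are unspecified.\<close>
  define H where "H r = max (-1) (min 1 (h r))" for r
  have [measurable]: "H \<in> borel_measurable borel" unfolding H_def by measurable
  have "continuous_on UNIV (\<lambda>y::real. arccos (max (-1) (min 1 y)))"
    by (intro continuous_intros) auto
  from borel_measurable_continuous_onI[OF this]
  have "(\<lambda>r. arccos (max (-1) (min 1 (h r)))) \<in> borel_measurable borel"
    by (rule measurable_compose[rotated]) simp
  then have [measurable]: "(\<lambda>r. arccos (H r)) \<in> borel_measurable borel"
    by (simp add: H_def)
  have H: "- 1 \<le> H r" "H r \<le> 1" for r by (auto simp: H_def)
  have Hh: "H r = h r" if "p < r" "r \<le> q" for r using h[OF that] by (auto simp: H_def)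
  have slice: "{s. vector [r, s] \<in> arc_polar_dom \<inter> arc_polar -` E} =
      (if p < r \<and> r \<le> q then {s. - pi * r < s \<and> \<bar>s\<bar> \<le> r * arccos (H r)} else {})" for r
  proof -
    have "vector [r, s] \<in> arc_polar_dom \<inter> arc_polar -` E \<longleftrightarrow>
      p < r \<and> r \<le> q \<and> - pi * r < s \<and> \<bar>s\<bar> \<le> r * arccos (H r)" for s
    proof (cases "p < r \<and> r \<le> q \<and> - pi * r < s \<and> s \<le> pi * r")
      case True
      then have r: "0 < r" and th: "\<bar>s / r\<bar> \<le> pi" using p by (auto simp: abs_le_iff field_simps)
      have "vector [r, s] \<in> arc_polar_dom \<inter> arc_polar -` E \<longleftrightarrow> r * H r \<le> r * cos (s / r)"
        using True r Hh[of r] by (auto simp: arc_polar_dom_def E_def norm_arc_polar) (auto simp: arc_polar_def)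
      also have "\<dots> \<longleftrightarrow> H r \<le> cos \<bar>s / r\<bar>"
        using r by (simp only: mult_le_cancel_left_pos cos_abs_real)
      also have "\<dots> \<longleftrightarrow> arccos (cos \<bar>s / r\<bar>) \<le> arccos (H r)"
        using H[of r] by (subst arccos_le_mono) auto
      also have "\<dots> \<longleftrightarrow> \<bar>s / r\<bar> \<le> arccos (H r)"
        using th by (subst arccos_cos) auto
      also have "\<dots> \<longleftrightarrow> \<bar>s\<bar> \<le> r * arccos (H r)"
        using r by (simp add: field_simps)
      finally show ?thesis using True by auto
    next
      case False
      have "s \<le> pi * r" if "p < r" "\<bar>s\<bar> \<le> r * arccos (H r)"
      proof -
        have "r * arccos (H r) \<le> r * pi"
          using that p H[of r] by (intro mult_left_mono arccos_ubound) auto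
        then show ?thesis using that by (auto simp: mult.commute)
      qed
      with False show ?thesis
        by (auto simp: arc_polar_dom_def E_def norm_arc_polar)
    qed
    then show ?thesis by auto
  qed
  have meas: "emeasure lborel {s. vector [r, s] \<in> arc_polar_dom \<inter> arc_polar -` E} =
      ennreal (2 * (arccos (H r) * r) * indicator {p<..q} r)" for r
  proof (cases "p < r \<and> r \<le> q")
    case True
    define a where "a = r * arccos (H r)"
    have a: "0 \<le> a" "a \<le> pi * r"
      using True p H[of r] arccos_lbound[of "H r"] arccos_ubound[of "H r"]
      by (auto simp: a_def mult.commute)
    \<comment> \<open>For a full circle the parametrisation by a half-open interval drops one endpoint.\<close>
    have "{s. - pi * r < s \<and> \<bar>s\<bar> \<le> a} = (if a < pi * r then {-a..a} else {-a<..a})"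
      using a by auto
    then have "emeasure lborel {s. - pi * r < s \<and> \<bar>s\<bar> \<le> a} = ennreal (2 * a)"
      using a by auto
    then show ?thesis using True by (subst slice) (simp add: a_def mult_ac)
  next
    case False
    then show ?thesis by (subst slice) auto
  qed
  let ?f = "\<lambda>r. 2 * (arccos (H r) * r) * indicator {p<..q} r"
  have T: "arc_polar_dom \<inter> arc_polar -` E \<in> sets borel"
    using measurable_sets[OF arc_polar_measurable E] by (simp add: sets.Int)
  have f0: "0 \<le> ?f r" for r
    using p H[of r] arccos_lbound[of "H r"] by (auto simp: indicator_def)
  have em: "emeasure lborel (arc_polar_dom \<inter> arc_polar -` E) = (\<integral>\<^sup>+r. ennreal (?f r) \<partial>lborel)"
    by (simp only: emeasure_real2_slices[OF T] meas)
  obtain v where v: "0 \<le> v" "emeasure lborel (arc_polar_dom \<inter> arc_polar -` E) = ennreal v"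
  proof -
    have "emeasure lborel (arc_polar_dom \<inter> arc_polar -` E) < \<infinity>"
      using measure_arc_polar(2)[OF E bE] T by (auto simp: fmeasurable_def)
    then show ?thesis
      using that by (cases "emeasure lborel (arc_polar_dom \<inter> arc_polar -` E)") auto
  qed
  have "(?f has_integral v) UNIV"
    by (rule nn_integral_has_integral) (use f0 v em in auto)
  then have "measure lborel (arc_polar_dom \<inter> arc_polar -` E) = integral UNIV ?f"
    using v by (simp add: measure_def integral_unique)
  moreover have "measure lborel (arc_polar_dom \<inter> arc_polar -` E) = measure lebesgue (arc_polar_dom \<inter> arc_polar -` E)"
    using T by simp
  ultimately have "measure lebesgue E = integral UNIV ?f"
    by (simp only: measure_arc_polar(1)[OF E bE, symmetric])
  also have "\<dots> = integral UNIV (\<lambda>r. if r \<in> {p..q} then 2 * (arccos (h r) * r) else 0)"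
  proof (rule integral_spike[of "{p}"])
    show "(if r \<in> {p..q} then 2 * (arccos (h r) * r) else 0) = ?f r" if "r \<in> UNIV - {p}" for r
      using that Hh[of r] by (auto simp: indicator_def)
  qed auto
  also have "\<dots> = integral {p..q} (\<lambda>r. 2 * (arccos (h r) * r))"
    by (rule integral_restrict_UNIV)
  finally show "measure lebesgue E = 2 * integral {p..q} (\<lambda>r. arccos (h r) * r)"
    by simp
qed

section \<open>The section as a plane region\<close>

lemma norm_complex2: "norm (z::complex^2) = sqrt ((cmod (z$1))\<^sup>2 + (cmod (z$2))\<^sup>2)"
  by (simp add: norm_vec_def L2_set_def sum_2)

text \<open>
  The isometry is \<open>w \<mapsto> t (a\<^sub>1, a\<^sub>2) + w (a\<^sub>2, - a\<^sub>1)\<close>: the first summand is the foot of the perpendicular from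
  the origin, the second runs through the complex orthogonal complement of \<open>a\<close>. The vector \<open>axis 1 1\<close> plays
  the role of the complex number 1.
\<close>

lemma A1C_cvec:
  fixes a :: "real^2"
  assumes "norm a = 1"
  shows "A1C (cvec a) (complex_of_real t) = measure lebesgue {x :: real^2.
    norm ((t * a$1) *\<^sub>R axis 1 1 + a$2 *\<^sub>R x) + norm ((t * a$2) *\<^sub>R axis 1 1 - a$1 *\<^sub>R x) \<le> 1}"
proof -
  define w where "w x = Complex (x$1) (x$2)" for x :: "real^2"
  have w_norm: "cmod (w x) = norm x" for x
    by (simp add: w_def norm_real2 complex_norm)
  have w_diff: "w x - w y = w (x - y)" for x y
    by (simp add: w_def complex_eq_iff)
  define \<phi> :: "real^2 \<Rightarrow> complex^2" where
    "\<phi> x = vector [of_real (t * a$1) + of_real (a$2) * w x, of_real (t * a$2) - of_real (a$1) * w x]" for x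
  have a: "(a$1)\<^sup>2 + (a$2)\<^sup>2 = 1"
    using assms by (simp add: norm_real2)
  have inner: "cinner (cvec a) z = of_real (a$1) * cnj (z$1) + of_real (a$2) * cnj (z$2)" for z
    by (simp add: cinner_def cvec_def sum_2)
  have aC: "complex_of_real (a$1) * of_real (a$1) + of_real (a$2) * of_real (a$2) = 1"
    using a by (simp add: power2_eq_square flip: of_real_mult of_real_add)
  have \<phi>: "isometric_param \<phi> (complex_line (cvec a) (of_real t))"
    unfolding isometric_param_def
  proof (intro conjI allI)
    fix x y
    have "norm (\<phi> x - \<phi> y) = sqrt ((a$2)\<^sup>2 * (cmod (w x - w y))\<^sup>2 + (a$1)\<^sup>2 * (cmod (w x - w y))\<^sup>2)"
    proof -
      have "(\<phi> x - \<phi> y) $ 1 = of_real (a$2) * (w x - w y)"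
        "(\<phi> x - \<phi> y) $ 2 = - of_real (a$1) * (w x - w y)"
        by (simp_all add: \<phi>_def algebra_simps)
      then show ?thesis
        by (simp only: norm_complex2 norm_mult norm_minus_cancel power_mult_distrib norm_of_real power2_abs)
    qed
    also have "\<dots> = sqrt (((a$1)\<^sup>2 + (a$2)\<^sup>2) * (cmod (w x - w y))\<^sup>2)"
      by (simp only: distrib_right add.commute)
    also have "\<dots> = norm (x - y)"
      by (simp add: a w_diff w_norm)
    finally show "dist (\<phi> x) (\<phi> y) = dist x y"
      by (simp add: dist_norm)
  next
    show "range \<phi> = complex_line (cvec a) (of_real t)"
    proof (intro equalityI subsetI)
      fix z assume "z \<in> range \<phi>"
      then obtain x where z: "z = \<phi> x" by auto
      have "cinner (cvec a) z = of_real t * (of_real (a$1) * of_real (a$1) + of_real (a$2) * of_real (a$2))"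
        by (simp add: z inner \<phi>_def algebra_simps)
      then show "z \<in> complex_line (cvec a) (of_real t)"
        by (simp add: complex_line_def aC)
    next
      fix z assume "z \<in> complex_line (cvec a) (of_real t)"
      then have "of_real (a$1) * cnj (z$1) + of_real (a$2) * cnj (z$2) = complex_of_real t"
        by (simp add: complex_line_def inner)
      from arg_cong[OF this, of cnj]
      have t: "of_real (a$1) * z$1 + of_real (a$2) * z$2 = complex_of_real t"
        by simp
      define v where "v = of_real (a$2) * z$1 - of_real (a$1) * z$2"
      define x :: "real^2" where "x = vector [Re v, Im v]"
      have wx: "w x = v" by (simp add: w_def x_def)
      have "of_real (t * a$1) + of_real (a$2) * v =
          (of_real (a$1) * of_real (a$1) + of_real (a$2) * of_real (a$2)) * z$1"
        "of_real (t * a$2) - of_real (a$1) * v =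
          (of_real (a$1) * of_real (a$1) + of_real (a$2) * of_real (a$2)) * z$2"
        unfolding v_def of_real_mult t[symmetric] by (simp_all add: algebra_simps)
      then have "z = \<phi> x"
        by (simp add: \<phi>_def wx vec_eq_iff forall_2 aC)
      then show "z \<in> range \<phi>" by simp
    qed
  qed
  have w_affine: "of_real c + of_real d * w x = w (c *\<^sub>R axis 1 1 + d *\<^sub>R x)" for c d x
    by (simp add: w_def complex_eq_iff axis_def)
  have "\<phi> -` {z \<in> B1. cinner (cvec a) z = of_real t} = {x :: real^2.
    norm ((t * a$1) *\<^sub>R axis 1 1 + a$2 *\<^sub>R x) + norm ((t * a$2) *\<^sub>R axis 1 1 - a$1 *\<^sub>R x) \<le> 1}"
  proof -
    have "cinner (cvec a) (\<phi> x) = of_real t" for x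
      using \<phi> by (auto simp: isometric_param_def complex_line_def)
    moreover have "cmod (\<phi> x $ 1) = norm ((t * a$1) *\<^sub>R axis 1 1 + a$2 *\<^sub>R x)" for x
      using w_affine[of "t * a$1" "a$2" x] by (simp add: \<phi>_def w_norm)
    moreover have "cmod (\<phi> x $ 2) = norm ((t * a$2) *\<^sub>R axis 1 1 - a$1 *\<^sub>R x)" for x
      using w_affine[of "t * a$2" "- a$1" x] by (simp add: \<phi>_def w_norm)
    ultimately show ?thesis by (auto simp: B1_def)
  qed
  then show ?thesis
    by (simp add: A1C_def vol2_eq[OF \<phi>])
qed

text \<open>
  The image of the section under projection to the coordinate \<open>z\<^sub>1 = u\<close>. On the line,
  \<open>z\<^sub>2 = (t - a\<^sub>1 u) / a\<^sub>2\<close>, and the defining inequality is \<open>\<bar>z\<^sub>1\<bar> + \<bar>z\<^sub>2\<bar> \<le> 1\<close> multiplied by \<open>a\<^sub>2\<close>.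
\<close>

definition section_z1 :: "real \<Rightarrow> real \<Rightarrow> real \<Rightarrow> (real^2) set" where
  "section_z1 a1 a2 t = {u. norm (t *\<^sub>R axis 1 1 - a1 *\<^sub>R u) \<le> a2 * (1 - norm u)}"

text \<open>
  In the coordinate \<open>w\<close> of \<open>A1C_cvec\<close>, \<open>z\<^sub>1 = t a\<^sub>1 + a\<^sub>2 w\<close> is a similarity with ratio \<open>a\<^sub>2\<close>.
\<close>

lemma A1C_eq_section_z1:
  fixes a :: "real^2"
  assumes "norm a = 1" "a$2 > 0"
  shows "A1C (cvec a) (complex_of_real t) = measure lebesgue (section_z1 (a$1) (a$2) t) / (a$2)\<^sup>2"
proof -
  let ?e = "axis 1 1 :: real^2"
  define E where "E = {x :: real^2.
    norm ((t * a$1) *\<^sub>R ?e + a$2 *\<^sub>R x) + norm ((t * a$2) *\<^sub>R ?e - a$1 *\<^sub>R x) \<le> 1}"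
  have a: "(a$1)\<^sup>2 + (a$2)\<^sup>2 = 1"
    using assms by (simp add: norm_real2)
  have iff: "a$2 *\<^sub>R x + (t * a$1) *\<^sub>R ?e \<in> section_z1 (a$1) (a$2) t \<longleftrightarrow> x \<in> E" for x
  proof -
    have *: "t *\<^sub>R ?e - a$1 *\<^sub>R (a$2 *\<^sub>R x + (t * a$1) *\<^sub>R ?e) = a$2 *\<^sub>R ((t * a$2) *\<^sub>R ?e - a$1 *\<^sub>R x)"
    proof -
      have "a$2 * (t * a$2) = t * (a$2)\<^sup>2" by (simp add: power2_eq_square)
      also have "(a$2)\<^sup>2 = 1 - (a$1)\<^sup>2" using a by simp
      also have "t * (1 - (a$1)\<^sup>2) = t - a$1 * (t * a$1)"
        by (simp add: power2_eq_square algebra_simps)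
      finally have "t - a$1 * (t * a$1) = a$2 * (t * a$2)" ..
      then have "(t - a$1 * (t * a$1)) *\<^sub>R ?e = (a$2 * (t * a$2)) *\<^sub>R ?e" by simp
      then show ?thesis by (simp add: algebra_simps)
    qed
    show ?thesis
      unfolding section_z1_def E_def mem_Collect_eq * norm_scaleR
      using assms(2) by (simp add: add.commute le_diff_eq)
  qed
  have "section_z1 (a$1) (a$2) t = (\<lambda>x. a$2 *\<^sub>R x + (t * a$1) *\<^sub>R ?e) ` E"
  proof (intro equalityI subsetI)
    fix u assume u: "u \<in> section_z1 (a$1) (a$2) t"
    define x where "x = (1 / a$2) *\<^sub>R (u - (t * a$1) *\<^sub>R ?e)"
    have "u = a$2 *\<^sub>R x + (t * a$1) *\<^sub>R ?e"
      using assms(2) by (simp add: x_def)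
    then show "u \<in> (\<lambda>x. a$2 *\<^sub>R x + (t * a$1) *\<^sub>R ?e) ` E"
      using u iff by blast
  qed (use iff in auto)
  then have "measure lebesgue (section_z1 (a$1) (a$2) t) = (a$2)\<^sup>2 * measure lebesgue E"
    by (simp only: measure_lebesgue_affine) simp
  then show ?thesis
    using assms(2) by (simp add: A1C_cvec[OF assms(1)] E_def)
qed

lemma norm_real2_power2: "(norm (x::real^2))\<^sup>2 = (x$1)\<^sup>2 + (x$2)\<^sup>2"
  by (simp add: norm_real2)

text \<open>
  Both sides of the defining inequality are nonnegative, so it may be squared; the left side expands by the
  law of cosines, and solving for \<open>u$1 = r cos \<theta>\<close> gives \<open>r\<close> times \<^const>\<open>f_sec\<close>.
\<close>

lemma section_z1_polar_iff:
  assumes "0 < t" "0 < a1" "0 < a2" "u \<noteq> 0" "norm u \<le> 1"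
  shows "u \<in> section_z1 a1 a2 t \<longleftrightarrow> norm u * f_sec a1 a2 t (norm u) \<le> u$1"
proof -
  define r where "r = norm u"
  have r: "0 < r" "r \<le> 1" using assms by (auto simp: r_def)
  have rr: "(u$1)\<^sup>2 + (u$2)\<^sup>2 = r\<^sup>2"
    by (simp add: r_def norm_real2)
  have n: "(norm (t *\<^sub>R axis 1 1 - a1 *\<^sub>R u))\<^sup>2 = t\<^sup>2 - 2 * t * a1 * u$1 + a1\<^sup>2 * r\<^sup>2"
    unfolding rr[symmetric] norm_real2_power2 by (simp add: axis_def power2_eq_square algebra_simps)
  have "u \<in> section_z1 a1 a2 t \<longleftrightarrow> (norm (t *\<^sub>R axis 1 1 - a1 *\<^sub>R u))\<^sup>2 \<le> (a2 * (1 - r))\<^sup>2"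
    using r assms by (simp add: section_z1_def r_def power_mono_iff)
  also have "\<dots> \<longleftrightarrow> t\<^sup>2 - a2\<^sup>2 + 2 * a2\<^sup>2 * r + (a1\<^sup>2 - a2\<^sup>2) * r\<^sup>2 \<le> 2 * t * a1 * u$1"
    unfolding n by (simp add: power_mult_distrib power2_eq_square algebra_simps)
  also have "\<dots> \<longleftrightarrow>
      (t\<^sup>2 - a2\<^sup>2 + 2 * a2\<^sup>2 * r + (a1\<^sup>2 - a2\<^sup>2) * r\<^sup>2) / (2 * t * a1) \<le> u$1"
    using assms by (subst pos_divide_le_eq) (simp_all add: mult.commute)
  also have "(t\<^sup>2 - a2\<^sup>2 + 2 * a2\<^sup>2 * r + (a1\<^sup>2 - a2\<^sup>2) * r\<^sup>2) / (2 * t * a1) = r * f_sec a1 a2 t r"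
    using r by (simp add: f_sec_def)
  finally show ?thesis by (simp add: r_def)
qed

text \<open>
  The two hypotheses say that the points of the circle of radius \<open>r\<close> nearest to and farthest from
  \<open>t / a\<^sub>1\<close> satisfy, respectively violate or just attain, the defining inequality of the region.
\<close>

lemma f_sec_bounds:
  assumes "0 < t" "0 < a1" "0 < r" "\<bar>t - a1 * r\<bar> \<le> a2 * (1 - r)" "a2 * (1 - r) \<le> t + a1 * r"
  shows "\<bar>f_sec a1 a2 t r\<bar> \<le> 1"
proof -
  have "\<bar>t - a1 * r\<bar>\<^sup>2 \<le> (a2 * (1 - r))\<^sup>2" "(a2 * (1 - r))\<^sup>2 \<le> (t + a1 * r)\<^sup>2"
    using power_mono[OF assms(4), of 2] power_mono[OF assms(5), of 2] assms(4) by auto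
  then have "t\<^sup>2 - a2\<^sup>2 + 2 * a2\<^sup>2 * r + (a1\<^sup>2 - a2\<^sup>2) * r\<^sup>2 \<le> 2 * t * a1 * r"
    "- (2 * t * a1 * r) \<le> t\<^sup>2 - a2\<^sup>2 + 2 * a2\<^sup>2 * r + (a1\<^sup>2 - a2\<^sup>2) * r\<^sup>2"
    by (simp_all add: power_mult_distrib power2_eq_square algebra_simps)
  moreover have "0 < 2 * t * a1 * r" using assms by simp
  ultimately show ?thesis
    unfolding f_sec_def abs_le_iff by (simp add: divide_le_eq le_divide_eq minus_divide_left)
qed

lemma section_z1_norm_bounds:
  assumes "u \<in> section_z1 a1 a2 t" "0 < a1" "0 \<le> t"
  shows "\<bar>t - a1 * norm u\<bar> \<le> a2 * (1 - norm u)"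
proof -
  have "\<bar>norm (t *\<^sub>R axis 1 1 :: real^2) - norm (a1 *\<^sub>R u)\<bar> \<le> norm (t *\<^sub>R axis 1 1 - a1 *\<^sub>R u)"
    by (rule norm_triangle_ineq3)
  also have "\<dots> \<le> a2 * (1 - norm u)" using assms by (simp add: section_z1_def)
  finally show ?thesis using assms by simp
qed

lemma f_sec_measurable [measurable]: "f_sec a1 a2 t \<in> borel_measurable borel"
  unfolding f_sec_def by measurable

section \<open>Area of the section for general direction\<close>

text \<open>
  The hypotheses on \<open>p\<close> hold for both lower integration limits of the proposition. They keep
  \<^const>\<open>f_sec\<close> between -1 and 1 for radii above \<open>p\<close> up to the upper limit, beyond which the region has no
  points. What happens below radius \<open>p\<close> depends on the case and stays as a separate term.
\<close>

lemma measure_section_z1: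
  assumes t: "0 < t" "t \<le> a1" and a: "0 < a2" "a2 \<le> a1" and p: "0 \<le> p"
    and p1: "(a2 - t) / (a1 + a2) \<le> p" and p2: "t - a2 \<le> (a1 - a2) * p"
  shows "measure lebesgue (section_z1 a1 a2 t) = measure lebesgue (section_z1 a1 a2 t \<inter> cball 0 p)
    + 2 * integral {p..(t + a2) / (a1 + a2)} (\<lambda>r. arccos (f_sec a1 a2 t r) * r)"
proof -
  define q where "q = (t + a2) / (a1 + a2)"
  have q: "q \<le> 1" "q * (a1 + a2) = t + a2" using t a by (auto simp: q_def field_simps)
  define F where "F = {u :: real^2. p < norm u \<and> norm u \<le> q \<and> norm u * f_sec a1 a2 t (norm u) \<le> u$1}"
  have f: "\<bar>f_sec a1 a2 t r\<bar> \<le> 1" if "p < r" "r \<le> q" for r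
  proof (rule f_sec_bounds)
    have "(a1 - a2) * p \<le> (a1 - a2) * r" using that a by (intro mult_left_mono) auto
    then have "t - a1 * r \<le> a2 * (1 - r)" using p2 by (simp add: algebra_simps)
    moreover have "r * (a1 + a2) \<le> q * (a1 + a2)" using that a by (intro mult_right_mono) auto
    then have "a1 * r - t \<le> a2 * (1 - r)" using q by (simp add: algebra_simps)
    ultimately show "\<bar>t - a1 * r\<bar> \<le> a2 * (1 - r)" by linarith
    have "(a2 - t) / (a1 + a2) \<le> r" using p1 that by linarith
    then show "a2 * (1 - r) \<le> t + a1 * r" using a by (simp add: field_simps)
  qed (use t a p that in auto)
  have split: "section_z1 a1 a2 t = (section_z1 a1 a2 t \<inter> cball 0 p) \<union> F"
  proof -
    have "u \<in> F \<longleftrightarrow> u \<in> section_z1 a1 a2 t" if "p < norm u" for u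
    proof (cases "norm u \<le> q")
      case True
      then show ?thesis
        using section_z1_polar_iff[of t a1 a2 u] that p q t a by (fastforce simp: F_def)
    next
      case False
      then have "q * (a1 + a2) < norm u * (a1 + a2)" using a by (intro mult_strict_right_mono) auto
      then have "a2 * (1 - norm u) < a1 * norm u - t" using q by (simp add: algebra_simps)
      then have "u \<notin> section_z1 a1 a2 t" using section_z1_norm_bounds[of u a1 a2 t] t a by auto
      then show ?thesis using False by (simp add: F_def)
    qed
    moreover have "p < norm u" if "u \<in> F" for u using that by (simp add: F_def)
    ultimately show ?thesis by auto (metis linorder_not_le)
  qed
  have "closed (section_z1 a1 a2 t)"
    unfolding section_z1_def by (intro closed_Collect_le continuous_intros)
  then have "compact (section_z1 a1 a2 t \<inter> cball 0 p)"
    by (intro closed_Int_compact) auto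
  then have P: "section_z1 a1 a2 t \<inter> cball 0 p \<in> lmeasurable"
    by (rule lmeasurable_compact)
  have F: "F \<in> lmeasurable"
    "measure lebesgue F = 2 * integral {p..q} (\<lambda>r. arccos (f_sec a1 a2 t r) * r)"
    unfolding F_def by (rule measure_polar_region[OF f_sec_measurable p f]; assumption)+
  have "measure lebesgue (section_z1 a1 a2 t) =
      measure lebesgue (section_z1 a1 a2 t \<inter> cball 0 p) + measure lebesgue (F - section_z1 a1 a2 t \<inter> cball 0 p)"
    by (subst split) (rule measure_Un2[OF P F(1)])
  also have "F - section_z1 a1 a2 t \<inter> cball 0 p = F"
    by (auto simp: F_def)
  finally show ?thesis using F(2) by (simp add: q_def)
qed

lemma measure_cball_real2: "0 \<le> r \<Longrightarrow> measure lebesgue (cball (c::real^2) r) = pi * r\<^sup>2"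
  by (simp add: content_cball unit_ball_vol_2)

text \<open>
  Below the lower limit \<open>p\<close>, every point satisfies the inequality already by the triangle inequality
  \<open>\<bar>t - a\<^sub>1 u\<bar> \<le> t + a\<^sub>1 \<bar>u\<bar>\<close>, so the inner part is a full disc. For \<open>t = 0\<close> the region is nothing but this disc
  and the integral runs over a single point.
\<close>

lemma measure_section_z1_small:
  assumes t: "0 \<le> t" "t \<le> a2" and a: "0 < a2" "a2 \<le> a1"
  shows "measure lebesgue (section_z1 a1 a2 t) = pi * ((a2 - t) / (a1 + a2))\<^sup>2
    + 2 * integral {(a2 - t) / (a1 + a2)..(a2 + t) / (a1 + a2)} (\<lambda>r. arccos (f_sec a1 a2 t r) * r)"
proof (cases "t = 0")
  case True
  have "u \<in> section_z1 a1 a2 t \<longleftrightarrow> u \<in> cball 0 (a2 / (a1 + a2))" for u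
  proof -
    have "u \<in> section_z1 a1 a2 t \<longleftrightarrow> a1 * norm u \<le> a2 * (1 - norm u)"
      using a by (simp add: section_z1_def True)
    also have "\<dots> \<longleftrightarrow> norm u \<le> a2 / (a1 + a2)"
      using a by (simp add: field_simps)
    finally show ?thesis by simp
  qed
  then have "section_z1 a1 a2 t = cball 0 (a2 / (a1 + a2))" by blast
  then show ?thesis using a True by (simp add: measure_cball_real2 del: measure_completion)
next
  case False
  define p where "p = (a2 - t) / (a1 + a2)"
  have p: "0 \<le> p" "p * (a1 + a2) = a2 - t" using t a by (auto simp: p_def)
  have "cball 0 p \<subseteq> section_z1 a1 a2 t"
  proof
    fix u :: "real^2" assume "u \<in> cball 0 p"
    then have "norm u * (a1 + a2) \<le> p * (a1 + a2)" using a by (intro mult_right_mono) auto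
    then have "t + a1 * norm u \<le> a2 * (1 - norm u)" using p by (simp add: algebra_simps)
    moreover have "norm (t *\<^sub>R axis 1 1 - a1 *\<^sub>R u) \<le> t + a1 * norm u"
      using norm_triangle_ineq4[of "t *\<^sub>R axis 1 1" "a1 *\<^sub>R u"] t a by simp
    ultimately show "u \<in> section_z1 a1 a2 t" by (simp add: section_z1_def)
  qed
  then have "section_z1 a1 a2 t \<inter> cball 0 p = cball 0 p" by auto
  moreover have "t - a2 \<le> (a1 - a2) * p"
  proof -
    have "0 \<le> (a1 - a2) * p" using p a by simp
    then show ?thesis using t by linarith
  qed
  ultimately show ?thesis
    using measure_section_z1[of t a1 a2 p] t a p False
    by (simp add: measure_cball_real2 p_def add.commute del: measure_completion)
qed

text \<open>
  Below the lower limit \<open>p\<close>, no point satisfies the inequality, because \<open>\<bar>t - a\<^sub>1 u\<bar> \<ge> t - a\<^sub>1 \<bar>u\<bar>\<close>.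
\<close>

lemma measure_section_z1_large:
  assumes t: "a2 < t" "t \<le> a1" and a: "0 < a2"
  shows "measure lebesgue (section_z1 a1 a2 t) =
    2 * integral {(t - a2) / (a1 - a2)..(t + a2) / (a1 + a2)} (\<lambda>r. arccos (f_sec a1 a2 t r) * r)"
proof -
  define p where "p = (t - a2) / (a1 - a2)"
  have p: "0 \<le> p" "p * (a1 - a2) = t - a2" using t a by (auto simp: p_def)
  have "section_z1 a1 a2 t \<inter> cball 0 p \<subseteq> sphere 0 p"
  proof
    fix u assume u: "u \<in> section_z1 a1 a2 t \<inter> cball 0 p"
    have "p \<le> norm u"
    proof (rule ccontr)
      assume "\<not> p \<le> norm u"
      then have "norm u * (a1 - a2) < p * (a1 - a2)" using t by (intro mult_strict_right_mono) auto
      then have "a2 * (1 - norm u) < t - a1 * norm u" using p by (simp add: algebra_simps)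
      then show False using section_z1_norm_bounds[of u a1 a2 t] u t a by auto
    qed
    then show "u \<in> sphere 0 p" using u by simp
  qed
  then have "measure lebesgue (section_z1 a1 a2 t \<inter> cball 0 p) = 0"
    using negligible_sphere negligible_subset negligible_imp_measure0 by metis
  moreover have "(a2 - t) / (a1 + a2) \<le> p"
  proof -
    have "(a2 - t) / (a1 + a2) \<le> 0" using t a by (simp add: divide_nonpos_pos)
    then show ?thesis using p by linarith
  qed
  ultimately show ?thesis
    using measure_section_z1[of t a1 a2 p] t a p
    by (simp add: p_def)
qed

section \<open>Closed forms\<close>

text \<open>
  The left-hand inequality is squared twice; the second conjunct on the right records that the second squaring
  has nonnegative sides. For \<open>c = A\<close> the first conjunct alone describes the whole line \<open>y = 0\<close>, and the second
  cuts out the segment between the foci.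
\<close>

lemma ellipse_foci_iff:
  fixes x y c A :: real
  assumes "0 < A" "0 \<le> c" "c \<le> A"
  shows "sqrt ((x + c)\<^sup>2 + y\<^sup>2) + sqrt ((x - c)\<^sup>2 + y\<^sup>2) \<le> 2 * A \<longleftrightarrow>
    (A\<^sup>2 - c\<^sup>2) * x\<^sup>2 + A\<^sup>2 * y\<^sup>2 \<le> A\<^sup>2 * (A\<^sup>2 - c\<^sup>2) \<and> x\<^sup>2 + y\<^sup>2 + c\<^sup>2 \<le> 2 * A\<^sup>2"
proof -
  define d where "d = sqrt ((x + c)\<^sup>2 + y\<^sup>2)"
  define e where "e = sqrt ((x - c)\<^sup>2 + y\<^sup>2)"
  define S where "S = x\<^sup>2 + y\<^sup>2 + c\<^sup>2"
  have d: "0 \<le> d" "d\<^sup>2 = (x + c)\<^sup>2 + y\<^sup>2" and e: "0 \<le> e" "e\<^sup>2 = (x - c)\<^sup>2 + y\<^sup>2"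
    by (simp_all add: d_def e_def)
  have sum: "d\<^sup>2 + e\<^sup>2 = 2 * S"
    unfolding d e S_def by (simp add: power2_eq_square algebra_simps)
  have prod: "(d * e)\<^sup>2 = S\<^sup>2 - 4 * c\<^sup>2 * x\<^sup>2"
    unfolding power_mult_distrib d e S_def by (simp add: power2_eq_square algebra_simps)
  have "d + e \<le> 2 * A \<longleftrightarrow> (d + e)\<^sup>2 \<le> (2 * A)\<^sup>2"
    using d e assms by (subst power_mono_iff) auto
  also have "\<dots> \<longleftrightarrow> d * e \<le> 2 * A\<^sup>2 - S"
  proof -
    have "(d + e)\<^sup>2 = 2 * S + 2 * (d * e)" using sum by (simp add: power2_sum)
    then show ?thesis by (auto simp: power_mult_distrib)
  qed
  also have "\<dots> \<longleftrightarrow> (d * e)\<^sup>2 \<le> (2 * A\<^sup>2 - S)\<^sup>2 \<and> S \<le> 2 * A\<^sup>2"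
  proof
    assume *: "d * e \<le> 2 * A\<^sup>2 - S"
    moreover have "0 \<le> d * e" using d e by simp
    ultimately show "(d * e)\<^sup>2 \<le> (2 * A\<^sup>2 - S)\<^sup>2 \<and> S \<le> 2 * A\<^sup>2"
      using power_mono[OF *, of 2] by simp
  next
    assume "(d * e)\<^sup>2 \<le> (2 * A\<^sup>2 - S)\<^sup>2 \<and> S \<le> 2 * A\<^sup>2"
    then show "d * e \<le> 2 * A\<^sup>2 - S"
      by (auto intro: power2_le_imp_le)
  qed
  also have "(d * e)\<^sup>2 \<le> (2 * A\<^sup>2 - S)\<^sup>2 \<longleftrightarrow>
      (A\<^sup>2 - c\<^sup>2) * x\<^sup>2 + A\<^sup>2 * y\<^sup>2 \<le> A\<^sup>2 * (A\<^sup>2 - c\<^sup>2)"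
  proof -
    have scale: "b - a = 4 * (v - u) \<Longrightarrow> a \<le> b \<longleftrightarrow> u \<le> v" for a b u v :: real
      by auto
    have *: "(2 * A\<^sup>2 - S)\<^sup>2 - (d * e)\<^sup>2 =
        4 * (A\<^sup>2 * (A\<^sup>2 - c\<^sup>2) - ((A\<^sup>2 - c\<^sup>2) * x\<^sup>2 + A\<^sup>2 * y\<^sup>2))"
      unfolding prod S_def by (simp add: power2_eq_square algebra_simps)
    show ?thesis by (rule scale[OF *])
  qed
  finally show ?thesis by (simp add: d_def e_def S_def)
qed

lemma measure_ellipse:
  fixes A c :: real
  assumes A: "0 < A" "0 \<le> c" "c \<le> A"
  shows "measure lebesgue {x :: real^2. norm (x + c *\<^sub>R axis 1 1) + norm (x - c *\<^sub>R axis 1 1) \<le> 2 * A}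
    = pi * A * sqrt (A\<^sup>2 - c\<^sup>2)" (is "measure lebesgue ?E = _")
proof -
  have E: "?E = {x. (A\<^sup>2 - c\<^sup>2) * (x$1)\<^sup>2 + A\<^sup>2 * (x$2)\<^sup>2 \<le> A\<^sup>2 * (A\<^sup>2 - c\<^sup>2) \<and>
      (x$1)\<^sup>2 + (x$2)\<^sup>2 + c\<^sup>2 \<le> 2 * A\<^sup>2}"
    using ellipse_foci_iff[OF A] by (simp add: norm_real2 axis_def)
  show ?thesis
  proof (cases "c = A")
    case True
    have "x$2 = 0" if "x \<in> ?E" for x
    proof -
      have "A\<^sup>2 * (x$2)\<^sup>2 \<le> 0" using that unfolding E by (simp add: True)
      then have "(x$2)\<^sup>2 \<le> 0" using A(1) by (simp add: mult_le_0_iff)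
      then show ?thesis by simp
    qed
    then have "?E \<subseteq> {x. x$2 = 0}" by blast
    then have "negligible ?E"
      by (rule negligible_subset[OF negligible_standard_hyperplane_cart])
    then have "measure lebesgue ?E = 0"
      by (rule negligible_imp_measure0)
    then show ?thesis by (simp add: True)
  next
    case False
    define B where "B = sqrt (A\<^sup>2 - c\<^sup>2)"
    have "c\<^sup>2 < A\<^sup>2" using A False by (intro power_strict_mono) auto
    then have B: "0 < B" "B\<^sup>2 = A\<^sup>2 - c\<^sup>2" by (simp_all add: B_def)
    \<comment> \<open>The ellipse is the unit disc stretched by its semi-axes \<open>A\<close> and \<open>B\<close>.\<close>
    define m :: "2 \<Rightarrow> real" where "m k = (if k = 1 then A else B)" for k
    have m: "m 1 = A" "m 2 = B" by (simp_all add: m_def)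
    have iff: "x \<in> ?E \<longleftrightarrow> (x$1 / A)\<^sup>2 + (x$2 / B)\<^sup>2 \<le> 1" for x :: "real^2"
    proof -
      have "(x$1 / A)\<^sup>2 + (x$2 / B)\<^sup>2 \<le> 1 \<longleftrightarrow> B\<^sup>2 * (x$1)\<^sup>2 + A\<^sup>2 * (x$2)\<^sup>2 \<le> A\<^sup>2 * B\<^sup>2"
      proof -
        have "(x$1 / A)\<^sup>2 + (x$2 / B)\<^sup>2 = (B\<^sup>2 * (x$1)\<^sup>2 + A\<^sup>2 * (x$2)\<^sup>2) / (A\<^sup>2 * B\<^sup>2)"
          using A(1) B(1) by (simp add: power_divide add_divide_distrib)
        moreover have "0 < A\<^sup>2 * B\<^sup>2" using A(1) B(1) by simp
        ultimately show ?thesis by (simp only: pos_divide_le_eq mult_1_left)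
      qed
      moreover have "(x$1)\<^sup>2 + (x$2)\<^sup>2 + c\<^sup>2 \<le> 2 * A\<^sup>2" if *: "(x$1 / A)\<^sup>2 + (x$2 / B)\<^sup>2 \<le> 1"
      proof -
        have "(x$1 / A)\<^sup>2 \<le> 1" "(x$2 / B)\<^sup>2 \<le> 1"
          using * zero_le_power2[of "x$1 / A"] zero_le_power2[of "x$2 / B"] by linarith+
        then have "(x$1)\<^sup>2 \<le> A\<^sup>2" "(x$2)\<^sup>2 \<le> B\<^sup>2"
          using A(1) B(1) by (simp_all add: power_divide)
        then show ?thesis using B by simp
      qed
      ultimately show ?thesis unfolding E mem_Collect_eq B(2)[symmetric] by blast
    qed
    have "?E = (\<lambda>x. \<chi> k. m k * x$k) ` cball 0 1"
    proof (intro equalityI subsetI)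
      fix x assume "x \<in> ?E"
      then have "(vector [x$1 / A, x$2 / B] :: real^2) \<in> cball 0 1"
        using iff by (simp add: norm_real2)
      moreover have "x = (\<chi> k. m k * (vector [x$1 / A, x$2 / B] :: real^2) $ k)"
        using A B by (simp add: vec_eq_iff forall_2 m)
      ultimately show "x \<in> (\<lambda>x. \<chi> k. m k * x$k) ` cball 0 1" by blast
    next
      fix x assume "x \<in> (\<lambda>x. \<chi> k. m k * x$k) ` cball 0 1"
      then obtain y where "y \<in> cball 0 1" "x = (\<chi> k. m k * y$k)" by blast
      then show "x \<in> ?E"
        unfolding iff using A B by (simp add: m norm_real2)
    qed
    then have "measure lebesgue ?E = \<bar>prod m UNIV\<bar> * measure lebesgue (cball (0::real^2) 1)"
      by (simp only: measure_stretch lmeasurable_cball)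
    also have "\<dots> = pi * A * B"
      using A B by (simp add: measure_cball_real2 UNIV_2 m del: measure_completion)
    finally show ?thesis by (simp add: B_def)
  qed
qed

text \<open>
  The polynomials come from integrating \<open>x arccos x\<close> and \<open>arccos x\<close> by parts.
\<close>

lemma arccos_moment_antiderivative:
  assumes "\<bar>x\<bar> < 1"
  shows "((\<lambda>x. (x\<^sup>2 / 2 - c * x - 1 / 4) * arccos x + (c - x / 4) * sqrt (1 - x\<^sup>2))
    has_real_derivative (x - c) * arccos x) (at x)"
proof -
  have x: "- 1 < x" "x < 1" using assms by auto
  define s where "s = sqrt (1 - x\<^sup>2)"
  have "x\<^sup>2 < 1" using x by (simp add: abs_square_less_1)
  then have s: "0 < s" "s\<^sup>2 = 1 - x\<^sup>2" by (simp_all add: s_def)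
  have "((\<lambda>x. (x\<^sup>2 / 2 - c * x - 1 / 4) * arccos x + (c - x / 4) * sqrt (1 - x\<^sup>2))
    has_real_derivative
      (x - c) * arccos x + (x\<^sup>2 / 2 - c * x - 1 / 4) * inverse (- s)
        + (- 1 / 4) * s + (c - x / 4) * (- x * inverse s)) (at x)"
    unfolding s_def using x \<open>x\<^sup>2 < 1\<close>
    by (auto intro!: derivative_eq_intros
        simp: power2_eq_square algebra_simps add_divide_distrib diff_divide_distrib)
  also have "(x - c) * arccos x + (x\<^sup>2 / 2 - c * x - 1 / 4) * inverse (- s)
        + (- 1 / 4) * s + (c - x / 4) * (- x * inverse s)
      = (x - c) * arccos x + (1 - x\<^sup>2 - s\<^sup>2) / (4 * s)"
    using s(1) by (simp add: divide_simps) (simp add: power2_eq_square algebra_simps)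
  also have "\<dots> = (x - c) * arccos x" by (simp add: s)
  finally show ?thesis .
qed

text \<open>
  With \<open>x = c + k r\<close> the integrand is \<open>(x - c) arccos x / k\<close>, and \<open>x\<close> runs from \<open>c\<close> to 1. The interior form of
  the fundamental theorem is used since \<^const>\<open>arccos\<close> is not differentiable at 1.
\<close>

lemma has_integral_arccos_moment:
  assumes c: "- 1 < c" "c \<le> 1" and k: "0 < k"
  shows "((\<lambda>r. arccos (c + k * r) * r) has_integral
    ((1 + 2 * c\<^sup>2) * arccos c - 3 * c * sqrt (1 - c\<^sup>2)) / (4 * k\<^sup>2)) {0..(1 - c) / k}"
proof -
  define G where "G x = (x\<^sup>2 / 2 - c * x - 1 / 4) * arccos x + (c - x / 4) * sqrt (1 - x\<^sup>2)" for x
  define F where "F r = G (c + k * r) / k\<^sup>2" for r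
  have end1: "F ((1 - c) / k) = 0"
    using k by (simp add: F_def G_def)
  have "G c = - (((1 + 2 * c\<^sup>2) * arccos c - 3 * c * sqrt (1 - c\<^sup>2)) / 4)"
    by (simp add: G_def power2_eq_square algebra_simps add_divide_distrib diff_divide_distrib)
  then have end0: "F 0 = - (((1 + 2 * c\<^sup>2) * arccos c - 3 * c * sqrt (1 - c\<^sup>2)) / (4 * k\<^sup>2))"
    by (simp add: F_def)
  have "((\<lambda>r. arccos (c + k * r) * r) has_integral F ((1 - c) / k) - F 0) {0..(1 - c) / k}"
  proof (rule fundamental_theorem_of_calculus_interior)
    show "0 \<le> (1 - c) / k" using c k by simp
    have "- 1 \<le> c + k * r \<and> c + k * r \<le> 1" if "r \<in> {0..(1 - c) / k}" for r
    proof -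
      have "k * 0 \<le> k * r" using that k by (intro mult_left_mono) auto
      moreover have "r * k \<le> 1 - c" using that k by (simp add: pos_le_divide_eq)
      ultimately show ?thesis using c by (simp add: mult.commute)
    qed
    then show "continuous_on {0..(1 - c) / k} F"
      unfolding F_def G_def using k by (intro continuous_intros) auto
    fix r assume r: "r \<in> {0<..<(1 - c) / k}"
    have "k * 0 < k * r" using r k by (intro mult_strict_left_mono) auto
    moreover have "r * k < 1 - c" using r k by (simp add: pos_less_divide_eq)
    ultimately have x: "\<bar>c + k * r\<bar> < 1" using c by (simp add: mult.commute abs_less_iff)
    have "((\<lambda>r. G (c + k * r)) has_real_derivative (c + k * r - c) * arccos (c + k * r) * k) (at r)"
      using arccos_moment_antiderivative[OF x, of c] unfolding G_def
      by (rule DERIV_chain2) (auto intro!: derivative_eq_intros)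
    then have "(F has_real_derivative (c + k * r - c) * arccos (c + k * r) * k / k\<^sup>2) (at r)"
      unfolding F_def by (rule DERIV_cdivide)
    moreover have "(c + k * r - c) * arccos (c + k * r) * k / k\<^sup>2 = arccos (c + k * r) * r"
      using k by (simp add: power2_eq_square)
    ultimately show "(F has_vector_derivative arccos (c + k * r) * r) (at r)"
      by (simp add: has_real_derivative_iff_has_vector_derivative)
  qed
  then show ?thesis by (simp add: end0 end1)
qed

lemma A1C_axis:
  assumes "0 \<le> t" "t \<le> 1"
  shows "A1C (cvec (vector [1, 0])) (complex_of_real t) = pi * (1 - t)\<^sup>2"
proof -
  have "norm (vector [1, 0] :: real^2) = 1" by (simp add: norm_real2)
  then have "A1C (cvec (vector [1, 0])) (complex_of_real t) = measure lebesgue {x :: real^2. t + norm x \<le> 1}"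
    using A1C_cvec[of "vector [1, 0]" t] assms by simp
  also have "{x :: real^2. t + norm x \<le> 1} = cball 0 (1 - t)" by auto
  also have "measure lebesgue (cball (0::real^2) (1 - t)) = pi * (1 - t)\<^sup>2"
    using assms by (intro measure_cball_real2) auto
  finally show ?thesis .
qed

text \<open>
  In the coordinate \<open>w\<close> of \<open>A1C_cvec\<close> the section is \<open>\<bar>w + t\<bar> + \<bar>w - t\<bar> \<le> \<surd>2\<close>, an ellipse with foci \<open>\<plusminus> t\<close>.
\<close>

lemma A1C_diagonal:
  assumes "0 \<le> t" "t \<le> 1 / sqrt 2"
  shows "A1C (cvec ((1 / sqrt 2) *\<^sub>R vector [1, 1])) (complex_of_real t) = pi / 2 * sqrt (1 - 2 * t\<^sup>2)"
proof -
  define s :: real where "s = 1 / sqrt 2"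
  have s: "0 < s" "s\<^sup>2 = 1 / 2" by (simp_all add: s_def power_divide)
  define a :: "real^2" where "a = s *\<^sub>R vector [1, 1]"
  have a: "a$1 = s" "a$2 = s" by (simp_all add: a_def)
  have na: "norm a = 1" by (simp add: norm_real2 a s)
  have "norm ((t * s) *\<^sub>R axis 1 1 + s *\<^sub>R x) + norm ((t * s) *\<^sub>R axis 1 1 - s *\<^sub>R x) \<le> 1 \<longleftrightarrow>
    norm (x + t *\<^sub>R axis 1 1) + norm (x - t *\<^sub>R axis 1 1) \<le> 2 * s" for x :: "real^2"
  proof -
    have "(t * s) *\<^sub>R axis 1 1 + s *\<^sub>R x = s *\<^sub>R (x + t *\<^sub>R axis 1 1)"
      "(t * s) *\<^sub>R axis 1 1 - s *\<^sub>R x = (- s) *\<^sub>R (x - t *\<^sub>R axis 1 1)"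
      by (simp_all add: algebra_simps)
    then have "norm ((t * s) *\<^sub>R axis 1 1 + s *\<^sub>R x) + norm ((t * s) *\<^sub>R axis 1 1 - s *\<^sub>R x)
        = s * (norm (x + t *\<^sub>R axis 1 1) + norm (x - t *\<^sub>R axis 1 1))"
      using s by (simp only: norm_scaleR) (simp add: algebra_simps)
    moreover have "1 = s * (2 * s)" using s by (simp add: power2_eq_square)
    ultimately show ?thesis using s by (metis mult_le_cancel_left_pos)
  qed
  then have "A1C (cvec a) (complex_of_real t) =
      measure lebesgue {x :: real^2. norm (x + t *\<^sub>R axis 1 1) + norm (x - t *\<^sub>R axis 1 1) \<le> 2 * s}"
    by (simp only: A1C_cvec[OF na] a)
  also have "\<dots> = pi * s * sqrt (s\<^sup>2 - t\<^sup>2)"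
    using assms s by (intro measure_ellipse) (auto simp: s_def)
  also have "\<dots> = pi * (s * s) * sqrt (1 - 2 * t\<^sup>2)"
  proof -
    have "s\<^sup>2 - t\<^sup>2 = s\<^sup>2 * (1 - 2 * t\<^sup>2)" using s by (simp add: algebra_simps)
    then have "sqrt (s\<^sup>2 - t\<^sup>2) = s * sqrt (1 - 2 * t\<^sup>2)"
      using s(1) by (simp add: real_sqrt_mult)
    then show ?thesis by simp
  qed
  also have "s * s = 1 / 2" using s by (simp add: power2_eq_square)
  finally show ?thesis by (simp add: a_def s_def)
qed

text \<open>
  For \<open>a\<^sub>2 = t\<close> the constant term in the numerator of \<^const>\<open>f_sec\<close> vanishes, so one factor \<open>r\<close> cancels and the
  affine function \<open>c + k r\<close> with \<open>c = t / a\<^sub>1\<close> remains; the disc degenerates to a point.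
\<close>

lemma A1C_touching:
  assumes "0 \<le> t" "t < 1 / sqrt 2"
  shows "A1C (cvec (vector [sqrt (1 - t\<^sup>2), t])) (complex_of_real t) =
    2 * (1 + t\<^sup>2) / (1 - 2 * t\<^sup>2)\<^sup>2 * arccos (t / sqrt (1 - t\<^sup>2))
    - 6 * t / (1 - 2 * t\<^sup>2) powr (3 / 2)"
proof (cases "t = 0")
  case True
  then show ?thesis using A1C_axis[of 0] by simp
next
  case False
  then have t: "0 < t" using assms by simp
  have "t\<^sup>2 < (1 / sqrt 2)\<^sup>2" using assms by (intro power_strict_mono) auto
  then have t2: "2 * t\<^sup>2 < 1" by (simp add: power_divide)
  define a1 where "a1 = sqrt (1 - t\<^sup>2)"
  have a1: "0 < a1" "a1\<^sup>2 = 1 - t\<^sup>2" using t2 by (simp_all add: a1_def)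
  have "t < a1"
    by (rule power2_less_imp_less) (use a1 t2 in auto)
  define a :: "real^2" where "a = vector [a1, t]"
  have a: "a$1 = a1" "a$2 = t" by (simp_all add: a_def)
  have na: "norm a = 1" by (simp add: norm_real2 a a1)
  define c where "c = t / a1"
  define k where "k = (1 - 2 * t\<^sup>2) / (2 * t * a1)"
  have k: "0 < k" using t2 t a1 by (simp add: k_def)
  have c: "- 1 < c" "c \<le> 1"
    using t a1(1) \<open>t < a1\<close> by (simp_all add: c_def) (smt (verit) divide_pos_pos)
  have f: "arccos (f_sec a1 t t r) * r = arccos (c + k * r) * r" for r
  proof (cases "r = 0")
    case False
    have "f_sec a1 t t r = (2 * t * r * t + (1 - 2 * t\<^sup>2) * r * r) / (2 * t * a1 * r)"
      unfolding f_sec_def a1(2) by (simp add: power2_eq_square algebra_simps)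
    also have "\<dots> = c + k * r"
      using False t a1(1) by (simp add: c_def k_def add_divide_distrib)
    finally show ?thesis by simp
  qed simp
  have "1 - 2 * t\<^sup>2 = a1\<^sup>2 - t\<^sup>2" using a1(2) by simp
  also have "\<dots> = (a1 - t) * (a1 + t)"
    by (simp add: power2_eq_square algebra_simps)
  finally have "k = (a1 - t) * (a1 + t) / (2 * t * a1)" by (simp add: k_def)
  moreover have "1 - c = (a1 - t) / a1" using a1(1) by (simp add: c_def diff_divide_distrib)
  ultimately have top: "(t + t) / (a1 + t) = (1 - c) / k"
    using t a1(1) \<open>t < a1\<close> by simp
  have "A1C (cvec a) (complex_of_real t) =
      2 * integral {0..(1 - c) / k} (\<lambda>r. arccos (c + k * r) * r) / t\<^sup>2"
    using A1C_eq_section_z1[OF na, of t] measure_section_z1_small[of t t a1] t \<open>t < a1\<close>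
    by (simp only: a f top) simp
  also have "integral {0..(1 - c) / k} (\<lambda>r. arccos (c + k * r) * r) =
      ((1 + 2 * c\<^sup>2) * arccos c - 3 * c * sqrt (1 - c\<^sup>2)) / (4 * k\<^sup>2)"
    by (rule integral_unique[OF has_integral_arccos_moment[OF c k]])
  also have "2 * (((1 + 2 * c\<^sup>2) * arccos c - 3 * c * sqrt (1 - c\<^sup>2)) / (4 * k\<^sup>2)) / t\<^sup>2
      = 2 * ((1 + 2 * c\<^sup>2) * arccos c - 3 * c * sqrt (1 - c\<^sup>2)) / (4 * k\<^sup>2 * t\<^sup>2)"
    by simp
  also have "4 * k\<^sup>2 * t\<^sup>2 = (1 - 2 * t\<^sup>2)\<^sup>2 / a1\<^sup>2"
    using t by (simp add: k_def power_divide power_mult_distrib)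
  also have "2 * ((1 + 2 * c\<^sup>2) * arccos c - 3 * c * sqrt (1 - c\<^sup>2)) / ((1 - 2 * t\<^sup>2)\<^sup>2 / a1\<^sup>2)
      = 2 * (a1\<^sup>2 * ((1 + 2 * c\<^sup>2) * arccos c - 3 * c * sqrt (1 - c\<^sup>2))) / (1 - 2 * t\<^sup>2)\<^sup>2"
    by simp
  also have "a1\<^sup>2 * ((1 + 2 * c\<^sup>2) * arccos c - 3 * c * sqrt (1 - c\<^sup>2))
      = a1\<^sup>2 * (1 + 2 * c\<^sup>2) * arccos c - 3 * (a1 * c) * (a1 * sqrt (1 - c\<^sup>2))"
    by (simp add: power2_eq_square algebra_simps)
  also have "a1\<^sup>2 * (1 + 2 * c\<^sup>2) = 1 + t\<^sup>2"
  proof -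
    have "a1\<^sup>2 * (1 + 2 * c\<^sup>2) = a1\<^sup>2 + 2 * (a1 * c)\<^sup>2"
      by (simp add: power_mult_distrib algebra_simps)
    also have "a1 * c = t" using a1 by (simp add: c_def)
    finally show ?thesis by (simp add: a1)
  qed
  also have "a1 * c = t" using a1 by (simp add: c_def)
  also have "a1 * sqrt (1 - c\<^sup>2) = sqrt (1 - 2 * t\<^sup>2)"
  proof -
    have "a1 * sqrt (1 - c\<^sup>2) = sqrt (a1\<^sup>2 * (1 - c\<^sup>2))"
      using a1(1) by (simp add: real_sqrt_mult)
    also have "a1\<^sup>2 * (1 - c\<^sup>2) = 1 - 2 * t\<^sup>2"
    proof -
      have "a1\<^sup>2 * (1 - c\<^sup>2) = a1\<^sup>2 - (a1 * c)\<^sup>2"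
        by (simp add: power_mult_distrib algebra_simps)
      also have "a1 * c = t" using a1 by (simp add: c_def)
      finally show ?thesis by (simp add: a1)
    qed
    finally show ?thesis .
  qed
  also have "2 * ((1 + t\<^sup>2) * arccos c - 3 * t * sqrt (1 - 2 * t\<^sup>2)) / (1 - 2 * t\<^sup>2)\<^sup>2
      = 2 * (1 + t\<^sup>2) / (1 - 2 * t\<^sup>2)\<^sup>2 * arccos c - 6 * t / (1 - 2 * t\<^sup>2) powr (3 / 2)"
  proof -
    define d where "d = 1 - 2 * t\<^sup>2"
    have d: "0 < d" using t2 by (simp add: d_def)
    have "d powr (3 / 2) * sqrt d = d\<^sup>2"
      using d by (simp add: powr_half_sqrt[symmetric] powr_add[symmetric] powr_numeral)
    then have "sqrt d / d\<^sup>2 = 1 / d powr (3 / 2)"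
      using d by (simp add: field_simps)
    then have "6 * t * (sqrt d / d\<^sup>2) = 6 * t / d powr (3 / 2)" by simp
    then show ?thesis unfolding d_def[symmetric]
      by (simp add: diff_divide_distrib algebra_simps)
  qed
  finally show ?thesis by (simp add: a_def a1_def c_def)
qed

theorem proposition7p1:
  shows "(\<forall>(a :: real^2) (t :: real).
            a \<in> sphere 0 1 \<and> 1 \<ge> a $ 1 \<and> a $ 1 \<ge> a $ 2 \<and> a $ 2 > 0 \<and> t \<ge> 0 \<longrightarrow>
              (0 \<le> t \<and> t \<le> a $ 2 \<longrightarrow>
                 A1C (cvec a) (complex_of_real t) =
                   pi * ((1 - t / a $ 2) / (a $ 1 + a $ 2))\<^sup>2
                   + 2 / (a $ 2)\<^sup>2 *
                     integral {(a $ 2 - t) / (a $ 1 + a $ 2) .. (a $ 2 + t) / (a $ 1 + a $ 2)}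
                       (\<lambda>r. arccos (f_sec (a $ 1) (a $ 2) t r) * r)) \<and>
              (a $ 2 < t \<and> t \<le> a $ 1 \<longrightarrow>
                 A1C (cvec a) (complex_of_real t) =
                   2 / (a $ 2)\<^sup>2 *
                     integral {(t - a $ 2) / (a $ 1 - a $ 2) .. (t + a $ 2) / (a $ 1 + a $ 2)}
                       (\<lambda>r. arccos (f_sec (a $ 1) (a $ 2) t r) * r)))
       \<and> (\<forall>t :: real. 0 \<le> t \<and> t \<le> 1 \<longrightarrow>
            A1C (cvec (vector [1, 0])) (complex_of_real t) = pi * (1 - t)\<^sup>2)
       \<and> (\<forall>t :: real. 0 \<le> t \<and> t \<le> 1 / sqrt 2 \<longrightarrow>
            A1C (cvec ((1 / sqrt 2) *\<^sub>R vector [1, 1])) (complex_of_real t) =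
              pi / 2 * sqrt (1 - 2 * t\<^sup>2))
       \<and> (\<forall>t :: real. 0 \<le> t \<and> t < 1 / sqrt 2 \<longrightarrow>
            A1C (cvec (vector [sqrt (1 - t\<^sup>2), t])) (complex_of_real t) =
              2 * (1 + t\<^sup>2) / (1 - 2 * t\<^sup>2)\<^sup>2 * arccos (t / sqrt (1 - t\<^sup>2))
              - 6 * t / (1 - 2 * t\<^sup>2) powr (3 / 2))"
proof (intro conjI allI impI)
  fix a :: "real^2" and t :: real
  assume *: "a \<in> sphere 0 1 \<and> 1 \<ge> a $ 1 \<and> a $ 1 \<ge> a $ 2 \<and> a $ 2 > 0 \<and> t \<ge> 0"
  then have A: "A1C (cvec a) (complex_of_real t) = measure lebesgue (section_z1 (a$1) (a$2) t) / (a$2)\<^sup>2"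
    by (intro A1C_eq_section_z1) auto
  show "A1C (cvec a) (complex_of_real t) =
      pi * ((1 - t / a $ 2) / (a $ 1 + a $ 2))\<^sup>2
      + 2 / (a $ 2)\<^sup>2 *
        integral {(a $ 2 - t) / (a $ 1 + a $ 2) .. (a $ 2 + t) / (a $ 1 + a $ 2)}
          (\<lambda>r. arccos (f_sec (a $ 1) (a $ 2) t r) * r)" if "0 \<le> t \<and> t \<le> a $ 2"
  proof -
    have "(1 - t / a$2) / (a$1 + a$2) = ((a$2 - t) / (a$1 + a$2)) / a$2"
      using * by (simp add: field_simps)
    then have disc: "((1 - t / a$2) / (a$1 + a$2))\<^sup>2 = ((a$2 - t) / (a$1 + a$2))\<^sup>2 / (a$2)\<^sup>2"
      by (simp only: power_divide)
    show ?thesis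
      unfolding A disc using * that
      by (subst measure_section_z1_small) (simp_all only: add_divide_distrib, auto)
  qed
  show "A1C (cvec a) (complex_of_real t) =
      2 / (a $ 2)\<^sup>2 *
        integral {(t - a $ 2) / (a $ 1 - a $ 2) .. (t + a $ 2) / (a $ 1 + a $ 2)}
          (\<lambda>r. arccos (f_sec (a $ 1) (a $ 2) t r) * r)" if "a $ 2 < t \<and> t \<le> a $ 1"
    unfolding A using * that by (subst measure_section_z1_large) auto
qed (use A1C_axis A1C_diagonal A1C_touching in auto)

end
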